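(* Let $\sigma$ be a fixed spectral function. (i) If $\sigma\in L^q$ for some $q\in[1,\infty]$ with conjugate exponent $p$ (i.e. $\frac1p+\frac1q=1$), then $$L^\infty\subset L^p\subset L_\sigma\subset L^1$$ and $$\|Y\|_1\le\|Y\|_\sigma\le\|\sigma\|_q\cdot\|Y\|_p\quad\text{whenever }Y\in L^p.$$ (ii) If $\sigma$ is bounded (i.e. $\sigma\in L^\infty$), then moreover $L_\sigma=L^1$, the norms are equivalent and satisfy $$\|Y\|_1\le\|Y\|_\sigma\le\|\sigma\|_\infty\cdot\|Y\|_1 .$$
   Context: Let $(\Omega,\mathcal{F},P)$ be a probability space and $L^0$ the space of real-valued random variables, identified when almost surely equal; $L^p=L^p(\Omega,\mathcal{F},P)$ with norm $\|\cdot\|_p$. A spectral function is a nondecreasing function $\sigma:[0,1)\to[0,\infty)$ with $\int_0^1\sigma(u)\,du=1$; $\sigma\in L^q$ and $\|\sigma\|_q$ refer to Lebesgue measure on $[0,1)$. For a random variable $Y$ and $0<u<1$ let $F_Y^{-1}(u):=\inf\{y:P(Y\le y)\ge u\}$, and let $\rho_\sigma(Y):=\int_0^1\sigma(u)F_Y^{-1}(u)\,du$ when the integral exists. Put $\|Y\|_\sigma:=\rho_\sigma(|Y|)\in[0,\infty]$ for $Y\in L^0$ and $L_\sigma:=\{Y\in L^0:\|Y\|_\sigma<\infty\}$. Inclusions $\subset$ are not necessarily strict. *)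

theory Defs
  imports "HOL-Probability.Probability"
begin

text \<open>
  Random variables are represented by Borel measurable functions rather than by classes of
  almost surely equal ones. Every space and norm below depends only on the class: see
  \<open>Lp_norm_cong_AE\<close>, \<open>sigma_norm_cong_AE\<close> and their consequences for the spaces.
\<close>

text \<open>The exponent ranges over \<open>[1, \<infinity>]\<close>, where \<open>\<top>\<close> is \<open>\<infinity>\<close>. The case distinction on \<open>I\<close> is the
  extension of the \<open>p\<close>-th root to \<open>[0, \<infinity>]\<close>.\<close>

definition Lp_norm :: "'a measure \<Rightarrow> ennreal \<Rightarrow> ('a \<Rightarrow> real) \<Rightarrow> ennreal" where
  "Lp_norm M p f =
     (if p = \<top> then esssup M (\<lambda>x. ennreal \<bar>f x\<bar>)
      else let I = (\<integral>\<^sup>+x. ennreal (\<bar>f x\<bar> powr enn2real p) \<partial>M)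
           in if I = \<top> then \<top> else ennreal (enn2real I powr (1 / enn2real p)))"

definition Lp_space :: "'a measure \<Rightarrow> ennreal \<Rightarrow> ('a \<Rightarrow> real) set" where
  "Lp_space M p = {f \<in> borel_measurable M. Lp_norm M p f < \<top>}"

abbreviation lborel01 :: "real measure" where
  "lborel01 \<equiv> restrict_space lborel {0..<1}"

text \<open>The values of \<open>\<sigma>\<close> outside \<open>[0, 1)\<close> are irrelevant.\<close>

definition spectral_function :: "(real \<Rightarrow> real) \<Rightarrow> bool" where
  "spectral_function \<sigma> \<longleftrightarrow>
     mono_on {0..<1} \<sigma> \<and> (\<forall>u\<in>{0..<1}. 0 \<le> \<sigma> u) \<and> (\<integral>\<^sup>+u. ennreal (\<sigma> u) \<partial>lborel01) = 1"

text \<open>Only meaningful for \<open>0 < u < 1\<close>, where the set is nonempty and bounded below.\<close>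

definition quantile :: "'a measure \<Rightarrow> ('a \<Rightarrow> real) \<Rightarrow> real \<Rightarrow> real" where
  "quantile M Y u = Inf {y. u \<le> measure M {x \<in> space M. Y x \<le> y}}"

text \<open>The integral as an extended real: the integral of the positive part minus that of the
  negative part. The value is irrelevant if both are infinite, i.e. if the integral does not
  exist.\<close>

definition spectral_risk :: "'a measure \<Rightarrow> (real \<Rightarrow> real) \<Rightarrow> ('a \<Rightarrow> real) \<Rightarrow> ereal" where
  "spectral_risk M \<sigma> Y =
     enn2ereal (\<integral>\<^sup>+u\<in>{0<..<1}. ennreal (\<sigma> u * quantile M Y u) \<partial>lborel)
     - enn2ereal (\<integral>\<^sup>+u\<in>{0<..<1}. ennreal (- (\<sigma> u * quantile M Y u)) \<partial>lborel)"

text \<open>The conversion \<open>e2ennreal\<close> loses nothing: see \<open>spectral_risk_abs_eq\<close>.\<close>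

definition sigma_norm :: "'a measure \<Rightarrow> (real \<Rightarrow> real) \<Rightarrow> ('a \<Rightarrow> real) \<Rightarrow> ennreal" where
  "sigma_norm M \<sigma> Y = e2ennreal (spectral_risk M \<sigma> (\<lambda>x. \<bar>Y x\<bar>))"

definition sigma_space :: "'a measure \<Rightarrow> (real \<Rightarrow> real) \<Rightarrow> ('a \<Rightarrow> real) set" where
  "sigma_space M \<sigma> = {Y \<in> borel_measurable M. sigma_norm M \<sigma> Y < \<top>}"

text \<open>\<open>N\<close> induces a (finite) norm on the vector space of classes of almost everywhere equal
  functions in \<open>V\<close>.\<close>

definition is_norm_AE :: "'a measure \<Rightarrow> ('a \<Rightarrow> real) set \<Rightarrow> (('a \<Rightarrow> real) \<Rightarrow> ennreal) \<Rightarrow> bool" where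
  "is_norm_AE M V N \<longleftrightarrow>
     (\<lambda>x. 0) \<in> V \<and>
     (\<forall>f\<in>V. \<forall>g\<in>V. (\<lambda>x. f x + g x) \<in> V) \<and>
     (\<forall>f\<in>V. \<forall>c. (\<lambda>x. c * f x) \<in> V) \<and>
     (\<forall>f\<in>V. N f < \<top>) \<and>
     (\<forall>f\<in>V. \<forall>g\<in>V. (AE x in M. f x = g x) \<longrightarrow> N f = N g) \<and>
     (\<forall>f\<in>V. N f = 0 \<longleftrightarrow> (AE x in M. f x = 0)) \<and>
     (\<forall>f\<in>V. \<forall>c. N (\<lambda>x. c * f x) = ennreal \<bar>c\<bar> * N f) \<and>
     (\<forall>f\<in>V. \<forall>g\<in>V. N (\<lambda>x. f x + g x) \<le> N f + N g)"

definition equivalent_norms_AE ::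
  "'a measure \<Rightarrow> ('a \<Rightarrow> real) set \<Rightarrow> (('a \<Rightarrow> real) \<Rightarrow> ennreal) \<Rightarrow> (('a \<Rightarrow> real) \<Rightarrow> ennreal) \<Rightarrow> bool" where
  "equivalent_norms_AE M V N\<^sub>1 N\<^sub>2 \<longleftrightarrow>
     is_norm_AE M V N\<^sub>1 \<and> is_norm_AE M V N\<^sub>2 \<and>
     (\<exists>c C :: real. 0 < c \<and> 0 < C \<and>
        (\<forall>f\<in>V. ennreal c * N\<^sub>1 f \<le> N\<^sub>2 f \<and> N\<^sub>2 f \<le> ennreal C * N\<^sub>1 f))"

lemma Lp_norm_cong_AE:
  assumes [measurable]: "f \<in> borel_measurable M" "g \<in> borel_measurable M"
    and eq: "AE x in M. f x = g x"
  shows "Lp_norm M p f = Lp_norm M p g"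
proof -
  have "esssup M (\<lambda>x. ennreal \<bar>f x\<bar>) = esssup M (\<lambda>x. ennreal \<bar>g x\<bar>)"
    using eq by (intro esssup_AE_cong) auto
  moreover have "(\<integral>\<^sup>+x. ennreal (\<bar>f x\<bar> powr enn2real p) \<partial>M) =
      (\<integral>\<^sup>+x. ennreal (\<bar>g x\<bar> powr enn2real p) \<partial>M)"
    using eq by (intro nn_integral_cong_AE) auto
  ultimately show ?thesis
    by (simp add: Lp_norm_def)
qed

lemma Lp_space_cong_AE:
  assumes "f \<in> borel_measurable M" "g \<in> borel_measurable M" "AE x in M. f x = g x"
  shows "f \<in> Lp_space M p \<longleftrightarrow> g \<in> Lp_space M p"
  using assms Lp_norm_cong_AE[OF assms] by (simp add: Lp_space_def)

lemma quantile_cong_AE: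
  assumes [measurable]: "X \<in> borel_measurable M" "Y \<in> borel_measurable M"
    and eq: "AE x in M. X x = Y x"
  shows "quantile M X = quantile M Y"
proof -
  have "measure M {x \<in> space M. X x \<le> y} = measure M {x \<in> space M. Y x \<le> y}" for y
    using eq by (intro measure_eq_AE) auto
  then show ?thesis
    by (simp add: quantile_def fun_eq_iff)
qed

lemma sigma_norm_cong_AE:
  assumes [measurable]: "X \<in> borel_measurable M" "Y \<in> borel_measurable M"
    and eq: "AE x in M. X x = Y x"
  shows "sigma_norm M \<sigma> X = sigma_norm M \<sigma> Y"
proof -
  have "quantile M (\<lambda>x. \<bar>X x\<bar>) = quantile M (\<lambda>x. \<bar>Y x\<bar>)"
    using eq by (intro quantile_cong_AE) auto
  then show ?thesis
    by (simp add: sigma_norm_def spectral_risk_def)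
qed

lemma sigma_space_cong_AE:
  assumes "X \<in> borel_measurable M" "Y \<in> borel_measurable M" "AE x in M. X x = Y x"
  shows "X \<in> sigma_space M \<sigma> \<longleftrightarrow> Y \<in> sigma_space M \<sigma>"
  using assms sigma_norm_cong_AE[OF assms] by (simp add: sigma_space_def)

lemma (in prob_space) quantile_eq_cdf:
  assumes "Y \<in> borel_measurable M"
  shows "quantile M Y u = Inf {y. u \<le> cdf (distr M borel Y) y}"
proof -
  have "cdf (distr M borel Y) y = prob {x \<in> space M. Y x \<le> y}" for y
    using assms by (auto simp: cdf_def measure_distr intro!: arg_cong[where f = prob])
  then show ?thesis
    by (simp add: quantile_def)
qed

lemma (in prob_space) quantile_nonneg:
  assumes Y: "Y \<in> borel_measurable M" and nonneg: "\<And>x. 0 \<le> Y x" and u: "0 < u" "u < 1"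
  shows "0 \<le> quantile M Y u"
proof -
  interpret D: cdf_distribution "distr M borel Y"
    using Y by (simp add: cdf_distribution_def)
  have "u \<le> cdf (distr M borel Y) (quantile M Y u)"
    using D.pseudoinverse[OF u, of "quantile M Y u"] quantile_eq_cdf[OF Y] by simp
  moreover have "cdf (distr M borel Y) y = prob {x \<in> space M. Y x \<le> y}" for y
    using Y by (auto simp: cdf_def measure_distr intro!: arg_cong[where f = prob])
  moreover have "{x \<in> space M. Y x \<le> y} = {}" if "y < 0" for y
    using that by (auto simp: not_le intro: less_le_trans[OF _ nonneg])
  ultimately show ?thesis
    using u(1) by (metis measure_empty not_le)
qed

lemma (in prob_space) spectral_risk_abs_eq:
  assumes \<sigma>: "spectral_function \<sigma>" and Y: "Y \<in> borel_measurable M"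
  shows "spectral_risk M \<sigma> (\<lambda>x. \<bar>Y x\<bar>) = enn2ereal (sigma_norm M \<sigma> Y)"
    and "sigma_norm M \<sigma> Y =
      (\<integral>\<^sup>+u\<in>{0<..<1}. ennreal (\<sigma> u * quantile M (\<lambda>x. \<bar>Y x\<bar>) u) \<partial>lborel)"
proof -
  let ?q = "quantile M (\<lambda>x. \<bar>Y x\<bar>)"
  have nonneg: "0 \<le> \<sigma> u * ?q u" if "0 < u" "u < 1" for u
    using \<sigma> Y that by (auto simp: spectral_function_def intro!: mult_nonneg_nonneg quantile_nonneg)
  have "(\<integral>\<^sup>+u\<in>{0<..<1}. ennreal (- (\<sigma> u * ?q u)) \<partial>lborel) = (\<integral>\<^sup>+(u::real). 0 \<partial>lborel)"
    by (intro nn_integral_cong) (use nonneg in \<open>fastforce simp: indicator_def intro!: ennreal_neg\<close>)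
  then have *: "spectral_risk M \<sigma> (\<lambda>x. \<bar>Y x\<bar>) =
      enn2ereal (\<integral>\<^sup>+u\<in>{0<..<1}. ennreal (\<sigma> u * ?q u) \<partial>lborel)"
    by (simp add: spectral_risk_def zero_ennreal.rep_eq)
  then show "spectral_risk M \<sigma> (\<lambda>x. \<bar>Y x\<bar>) = enn2ereal (sigma_norm M \<sigma> Y)"
    by (simp add: sigma_norm_def)
  show "sigma_norm M \<sigma> Y = (\<integral>\<^sup>+u\<in>{0<..<1}. ennreal (\<sigma> u * ?q u) \<partial>lborel)"
    using * by (simp add: sigma_norm_def)
qed

end

theory Submission
  imports Defs
begin

text \<open>
  The spectral norm \<open>\<parallel>Y\<parallel>\<^sub>\<sigma>\<close> is the integral over \<open>[0, 1)\<close> of the product of \<open>\<sigma>\<close> and the quantile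
  function \<open>F\<close> of \<open>\<bar>Y\<bar>\<close>. Both factors are nonnegative and nondecreasing, and under Lebesgue measure
  \<open>F\<close> has the law of \<open>\<bar>Y\<bar>\<close> (\<open>distr_abs_quantile\<close>), so that \<open>F\<close> and \<open>Y\<close> have the same \<open>L\<^sup>p\<close> norms.

  The two bounds are therefore bounds on the integral of a product. Since two nondecreasing functions
  are positively correlated, it is at least the product of the integrals, which is \<open>\<parallel>Y\<parallel>\<^sub>1\<close> because
  \<open>\<sigma>\<close> has integral one (\<open>Chebyshev_integral_inequality\<close>, \<open>L1_norm_le_sigma_norm\<close>). By
  Hoelder's inequality it is at most \<open>\<parallel>\<sigma>\<parallel>\<^sub>q \<parallel>Y\<parallel>\<^sub>p\<close> (\<open>sigma_norm_le_Lp_norm\<close>). The inclusions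
  into and of \<open>L\<^sub>\<sigma>\<close> follow from these bounds, while \<open>L\<^sup>\<infinity> \<subseteq> L\<^sup>p\<close> holds because the
  measure is finite. The case of bounded \<open>\<sigma>\<close> is \<open>q = \<infinity>\<close>, \<open>p = 1\<close>.

  Equivalence of norms also asks that \<open>\<parallel>\<cdot>\<parallel>\<^sub>\<sigma>\<close> be a norm, which holds on \<open>L\<^sub>\<sigma>\<close> for every spectral
  function (\<open>is_norm_AE_sigma_norm\<close>). Only the triangle inequality needs an idea. Writing \<open>\<sigma>\<close> as the
  integral over \<open>t > 0\<close> of the indicators of \<open>{\<sigma> > t}\<close>, which are intervals with right end
  point 1, reduces it to a tail integral \<open>\<integral>\<^sub>A F\<close> over one such interval \<open>A\<close>. Tail integrals are
  subadditive by the variational formula of Rockafellar and Uryasev for the average value at risk: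
  for nonempty \<open>A\<close>, \<open>\<integral>\<^sub>A F\<close> is the minimum over \<open>c \<ge> 0\<close> of \<open>c \<bar>A\<bar> + E (\<bar>Y\<bar> - c)\<^sup>+\<close>, and
  \<open>c\<close> and \<open>d\<close> optimal for \<open>X\<close> and \<open>Y\<close> make \<open>c + d\<close> admissible for \<open>X + Y\<close>.
\<close>

section \<open>Lebesgue spaces\<close>

lemma Lp_norm_finite_exponent:
  assumes "Lp_norm M p f < \<top>" "p \<noteq> \<top>"
  obtains A where "0 \<le> A" "(\<integral>\<^sup>+x. ennreal (\<bar>f x\<bar> powr enn2real p) \<partial>M) = ennreal A"
    "Lp_norm M p f = ennreal (A powr (1 / enn2real p))"
proof -
  let ?I = "\<integral>\<^sup>+x. ennreal (\<bar>f x\<bar> powr enn2real p) \<partial>M"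
  have fin: "?I \<noteq> \<top>"
    using assms by (auto simp: Lp_norm_def Let_def split: if_splits)
  show ?thesis
  proof (rule that)
    show "?I = ennreal (enn2real ?I)"
      using fin by (simp add: ennreal_enn2real top.not_eq_extremum)
    show "Lp_norm M p f = ennreal (enn2real ?I powr (1 / enn2real p))"
      using fin assms by (simp add: Lp_norm_def)
  qed simp
qed

lemma Lp_norm_one: "Lp_norm M 1 f = (\<integral>\<^sup>+x. ennreal \<bar>f x\<bar> \<partial>M)"
  by (auto simp: Lp_norm_def Let_def ennreal_enn2real top.not_eq_extremum)

text \<open>An \<open>L\<^sup>p\<close> norm depends only on the law. This is how norms of \<open>Y\<close> become norms of its
  quantile function.\<close>

lemma Lp_norm_distr:
  assumes [measurable]: "T \<in> M \<rightarrow>\<^sub>M N" "f \<in> borel_measurable N"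
  shows "Lp_norm (distr M N T) p f = Lp_norm M p (\<lambda>x. f (T x))"
proof -
  have "esssup (distr M N T) (\<lambda>x. ennreal \<bar>f x\<bar>) = esssup M (\<lambda>x. ennreal \<bar>f (T x)\<bar>)"
    by (simp add: esssup_eq_AE AE_distr_iff)
  then show ?thesis
    by (simp add: Lp_norm_def nn_integral_distr)
qed

lemma Lp_norm_abs: "Lp_norm M p (\<lambda>x. \<bar>f x\<bar>) = Lp_norm M p f"
  by (simp add: Lp_norm_def)

lemma conjugate_exponents_cases:
  fixes p q :: ennreal
  assumes "1 / p + 1 / q = 1"
  obtains (top_one) "p = \<top>" "q = 1"
    | (one_top) "p = 1" "q = \<top>"
    | (real) r s where "1 < r" "1 < s" "1 / r + 1 / s = 1" "p = ennreal r" "q = ennreal s"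
proof -
  have inv: "1 / ennreal t = (if t = 0 then \<top> else ennreal (1 / t))" if "0 \<le> t" for t
    using that by (auto simp: divide_ennreal_def inverse_ennreal inverse_eq_divide)
  show ?thesis
  proof (cases p)
    case top
    then have "1 / q = 1"
      using assms by simp
    then have "q = 1"
      using inv by (cases q) (auto split: if_splits)
    then show ?thesis
      using top that(1) by blast
  next
    case p: (real r)
    show ?thesis
    proof (cases q)
      case top
      then have "1 / p = 1"
        using assms by simp
      then have "p = 1"
        using p inv[of r] by (auto split: if_splits)
      then show ?thesis
        using top that(2) by blast
    next
      case q: (real s)
      have pos: "0 < r" "0 < s"
        using assms p q inv[of r] inv[of s] by (auto split: if_splits simp: order_less_le)
      then have "ennreal (1 / r + 1 / s) = 1"
        using assms p q inv[of r] inv[of s] by (simp add: ennreal_plus)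
      then have sum: "1 / r + 1 / s = 1"
        by simp
      then have "1 / r < 1" "1 / s < 1"
        using pos by (smt (verit) divide_pos_pos)+
      then show ?thesis
        using that(3)[of r s] sum pos p q by simp
    qed
  qed
qed

text \<open>Integrate Young's inequality for \<open>\<bar>f\<bar>\<close> and \<open>\<bar>g\<bar>\<close> divided by their norms \<open>a\<close> and \<open>b\<close>. If a
  norm vanishes, the normalization is impossible but the product is zero almost everywhere.\<close>

lemma nn_integral_Holder_real:
  fixes r s :: real
  assumes [measurable]: "f \<in> borel_measurable M" "g \<in> borel_measurable M"
    and rs: "1 < r" "1 < s" "1 / r + 1 / s = 1" and AB: "0 \<le> A" "0 \<le> B"
    and f: "(\<integral>\<^sup>+x. ennreal (\<bar>f x\<bar> powr r) \<partial>M) = ennreal A"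
    and g: "(\<integral>\<^sup>+x. ennreal (\<bar>g x\<bar> powr s) \<partial>M) = ennreal B"
  shows "(\<integral>\<^sup>+x. ennreal \<bar>f x * g x\<bar> \<partial>M) \<le> ennreal (A powr (1 / r)) * ennreal (B powr (1 / s))"
proof (cases "A = 0 \<or> B = 0")
  case True
  then have "AE x in M. f x * g x = 0"
  proof
    assume "A = 0"
    then have "(\<integral>\<^sup>+x. ennreal (\<bar>f x\<bar> powr r) \<partial>M) = 0"
      using f by simp
    then have "AE x in M. ennreal (\<bar>f x\<bar> powr r) = 0"
      by (subst (asm) nn_integral_0_iff_AE) auto
    then show ?thesis
      by eventually_elim simp
  next
    assume "B = 0"
    then have "(\<integral>\<^sup>+x. ennreal (\<bar>g x\<bar> powr s) \<partial>M) = 0"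
      using g by simp
    then have "AE x in M. ennreal (\<bar>g x\<bar> powr s) = 0"
      by (subst (asm) nn_integral_0_iff_AE) auto
    then show ?thesis
      by eventually_elim simp
  qed
  then have "(\<integral>\<^sup>+x. ennreal \<bar>f x * g x\<bar> \<partial>M) = 0"
    by (subst nn_integral_0_iff_AE) (auto elim: eventually_mono)
  then show ?thesis
    by simp
next
  case False
  define a b where "a = A powr (1 / r)" and "b = B powr (1 / s)"
  have pos: "0 < a" "0 < b" "a powr r = A" "b powr s = B"
    using False AB rs by (auto simp: a_def b_def powr_powr)
  have young: "\<bar>f x * g x\<bar> \<le> a * b / (r * A) * \<bar>f x\<bar> powr r + a * b / (s * B) * \<bar>g x\<bar> powr s" for x
  proof -
    have "\<bar>f x\<bar> / a * (\<bar>g x\<bar> / b) \<le> (\<bar>f x\<bar> / a) powr r / r + (\<bar>g x\<bar> / b) powr s / s"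
      using rs pos by (intro Youngs_inequality) auto
    also have "\<dots> = \<bar>f x\<bar> powr r / (r * A) + \<bar>g x\<bar> powr s / (s * B)"
      using pos by (simp add: powr_divide mult.commute)
    finally have "a * b * (\<bar>f x\<bar> / a * (\<bar>g x\<bar> / b)) \<le>
        a * b * (\<bar>f x\<bar> powr r / (r * A) + \<bar>g x\<bar> powr s / (s * B))"
      using pos by (intro mult_left_mono) auto
    then show ?thesis
      using pos by (simp add: abs_mult distrib_left)
  qed
  have nonneg: "0 \<le> a * b / (r * A)" "0 \<le> a * b / (s * B)"
    using pos rs AB by auto
  have "(\<integral>\<^sup>+x. ennreal \<bar>f x * g x\<bar> \<partial>M) \<le>
      (\<integral>\<^sup>+x. ennreal (a * b / (r * A)) * ennreal (\<bar>f x\<bar> powr r)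
            + ennreal (a * b / (s * B)) * ennreal (\<bar>g x\<bar> powr s) \<partial>M)"
  proof (rule nn_integral_mono)
    fix x
    have "ennreal \<bar>f x * g x\<bar> \<le>
        ennreal (a * b / (r * A) * \<bar>f x\<bar> powr r + a * b / (s * B) * \<bar>g x\<bar> powr s)"
      using young by (rule ennreal_leI)
    also have "\<dots> = ennreal (a * b / (r * A) * \<bar>f x\<bar> powr r) + ennreal (a * b / (s * B) * \<bar>g x\<bar> powr s)"
      using nonneg by (intro ennreal_plus mult_nonneg_nonneg) auto
    also have "\<dots> = ennreal (a * b / (r * A)) * ennreal (\<bar>f x\<bar> powr r)
        + ennreal (a * b / (s * B)) * ennreal (\<bar>g x\<bar> powr s)"
      using nonneg by (simp only: ennreal_mult')
    finally show "ennreal \<bar>f x * g x\<bar> \<le> \<dots>" .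
  qed
  also have "\<dots> = ennreal (a * b / (r * A)) * ennreal A + ennreal (a * b / (s * B)) * ennreal B"
    by (simp add: nn_integral_add nn_integral_cmult f g)
  also have "\<dots> = ennreal (a * b / (r * A) * A + a * b / (s * B) * B)"
    by (simp only: ennreal_mult'[OF nonneg(1)] ennreal_mult'[OF nonneg(2)]
        ennreal_plus[OF mult_nonneg_nonneg[OF nonneg(1) AB(1)] mult_nonneg_nonneg[OF nonneg(2) AB(2)]])
  also have "a * b / (r * A) * A + a * b / (s * B) * B = a * b * (1 / r + 1 / s)"
    using False by (simp add: distrib_left)
  also have "ennreal \<dots> = ennreal a * ennreal b"
    using pos rs by (simp add: ennreal_mult')
  finally show ?thesis
    by (simp add: a_def b_def)
qed

lemma nn_integral_Holder_top:
  assumes [measurable]: "f \<in> borel_measurable M" "g \<in> borel_measurable M"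
  shows "(\<integral>\<^sup>+x. ennreal \<bar>f x * g x\<bar> \<partial>M) \<le> Lp_norm M \<top> f * Lp_norm M 1 g"
proof -
  have "(\<integral>\<^sup>+x. ennreal \<bar>f x * g x\<bar> \<partial>M) \<le> (\<integral>\<^sup>+x. Lp_norm M \<top> f * ennreal \<bar>g x\<bar> \<partial>M)"
    using esssup_AE[of "\<lambda>x. ennreal \<bar>f x\<bar>" M]
    by (intro nn_integral_mono_AE, eventually_elim)
       (simp add: Lp_norm_def abs_mult ennreal_mult' mult_right_mono)
  also have "\<dots> = Lp_norm M \<top> f * Lp_norm M 1 g"
    by (simp add: Lp_norm_one nn_integral_cmult)
  finally show ?thesis .
qed

proposition nn_integral_Holder:
  assumes pq: "1 / p + 1 / q = 1" and f: "f \<in> Lp_space M p" and g: "g \<in> Lp_space M q"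
  shows "(\<integral>\<^sup>+x. ennreal \<bar>f x * g x\<bar> \<partial>M) \<le> Lp_norm M p f * Lp_norm M q g"
proof -
  have meas: "f \<in> borel_measurable M" "g \<in> borel_measurable M"
    and fin: "Lp_norm M p f < \<top>" "Lp_norm M q g < \<top>"
    using f g by (auto simp: Lp_space_def)
  from pq show ?thesis
  proof (cases rule: conjugate_exponents_cases)
    case top_one
    then show ?thesis
      using nn_integral_Holder_top[OF meas] by simp
  next
    case one_top
    then show ?thesis
      using nn_integral_Holder_top[OF meas(2,1)] by (simp add: mult.commute)
  next
    case (real r s)
    obtain A where A: "0 \<le> A" "(\<integral>\<^sup>+x. ennreal (\<bar>f x\<bar> powr r) \<partial>M) = ennreal A"
      "Lp_norm M p f = ennreal (A powr (1 / r))"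
      using Lp_norm_finite_exponent[OF fin(1)] real by auto
    obtain B where B: "0 \<le> B" "(\<integral>\<^sup>+x. ennreal (\<bar>g x\<bar> powr s) \<partial>M) = ennreal B"
      "Lp_norm M q g = ennreal (B powr (1 / s))"
      using Lp_norm_finite_exponent[OF fin(2)] real by auto
    show ?thesis
      unfolding A(3) B(3) using meas real A B by (intro nn_integral_Holder_real) auto
  qed
qed

lemma (in finite_measure) Lp_space_top_subset: "Lp_space M \<top> \<subseteq> Lp_space M p"
proof
  fix f assume f: "f \<in> Lp_space M \<top>"
  then have [measurable]: "f \<in> borel_measurable M" and fin: "Lp_norm M \<top> f < \<top>"
    by (auto simp: Lp_space_def)
  from fin obtain K where K: "0 \<le> K" "Lp_norm M \<top> f = ennreal K"
    by (cases "Lp_norm M \<top> f") auto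
  have bound: "AE x in M. \<bar>f x\<bar> \<le> K"
    using esssup_AE[of "\<lambda>x. ennreal \<bar>f x\<bar>" M] K by (auto simp: Lp_norm_def)
  have "Lp_norm M p f < \<top>" if "p \<noteq> \<top>"
  proof -
    have "(\<integral>\<^sup>+x. ennreal (\<bar>f x\<bar> powr enn2real p) \<partial>M) \<le> (\<integral>\<^sup>+x. ennreal (K powr enn2real p) \<partial>M)"
      using bound by (intro nn_integral_mono_AE, eventually_elim)
        (auto intro!: ennreal_leI powr_mono2)
    also have "\<dots> < \<top>"
      by (simp add: ennreal_mult_less_top less_top[symmetric] ennreal_mult_eq_top_iff)
    finally show ?thesis
      using that by (auto simp: Lp_norm_def Let_def)
  qed
  then show "f \<in> Lp_space M p"
    using f by (cases "p = \<top>") (auto simp: Lp_space_def)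
qed

section \<open>Integral inequalities\<close>

text \<open>Integrate \<open>(f x - f y) (g x - g y) \<ge> 0\<close> over \<open>x\<close> and \<open>y\<close>. The negative terms are moved to the
  other side first, so that the integrals may be infinite.\<close>

lemma Chebyshev_integral_inequality:
  fixes M :: "'b::linorder measure" and f g :: "'b \<Rightarrow> real"
  assumes "prob_space M" and [measurable]: "f \<in> borel_measurable M" "g \<in> borel_measurable M"
    and mono: "mono_on (space M) f" "mono_on (space M) g"
    and nonneg: "\<And>x. x \<in> space M \<Longrightarrow> 0 \<le> f x" "\<And>x. x \<in> space M \<Longrightarrow> 0 \<le> g x"
  shows "(\<integral>\<^sup>+x. ennreal (f x) \<partial>M) * (\<integral>\<^sup>+x. ennreal (g x) \<partial>M) \<le> (\<integral>\<^sup>+x. ennreal (f x * g x) \<partial>M)"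
proof -
  interpret prob_space M by fact
  let ?F = "\<integral>\<^sup>+x. ennreal (f x) \<partial>M" and ?G = "\<integral>\<^sup>+x. ennreal (g x) \<partial>M"
  let ?P = "\<integral>\<^sup>+x. ennreal (f x * g x) \<partial>M"
  have pointwise: "ennreal (f x) * ennreal (g y) + ennreal (g x) * ennreal (f y)
      \<le> ennreal (f x * g x) + ennreal (f y * g y)" if "x \<in> space M" "y \<in> space M" for x y
  proof -
    have "0 \<le> (f x - f y) * (g x - g y)"
    proof (cases "x \<le> y")
      case True
      then show ?thesis
        using mono that by (intro mult_nonpos_nonpos) (auto simp: mono_on_def)
    next
      case False
      then show ?thesis
        using mono that by (intro mult_nonneg_nonneg) (auto simp: mono_on_def)
    qed
    then have "f x * g y + g x * f y \<le> f x * g x + f y * g y"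
      by (simp add: algebra_simps)
    then show ?thesis
      using nonneg that by (simp flip: ennreal_mult' ennreal_plus add: ennreal_leI)
  qed
  have "2 * (?F * ?G) = (\<integral>\<^sup>+x. ennreal (f x) * ?G + ennreal (g x) * ?F \<partial>M)"
    by (simp add: nn_integral_add nn_integral_multc mult_2 mult.commute)
  also have "\<dots> = (\<integral>\<^sup>+x. (\<integral>\<^sup>+y. ennreal (f x) * ennreal (g y) + ennreal (g x) * ennreal (f y) \<partial>M) \<partial>M)"
    by (simp add: nn_integral_add nn_integral_cmult)
  also have "\<dots> \<le> (\<integral>\<^sup>+x. (\<integral>\<^sup>+y. ennreal (f x * g x) + ennreal (f y * g y) \<partial>M) \<partial>M)"
    by (intro nn_integral_mono pointwise)
  also have "\<dots> = 2 * ?P"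
    by (simp add: nn_integral_add emeasure_space_1 mult_2)
  finally show ?thesis
    by (simp add: ennreal_mult_le_mult_iff)
qed

text \<open>Write \<open>s x\<close> as the length of \<open>(0, s x)\<close> and exchange the integrals. With \<open>h\<close> the quantile
  function and \<open>s = \<sigma>\<close>, this is the representation of a spectral risk measure as a mixture of tail
  integrals.\<close>

lemma nn_integral_layer_cake:
  assumes "sigma_finite_measure M"
    and [measurable]: "s \<in> borel_measurable M" "h \<in> borel_measurable M"
  shows "(\<integral>\<^sup>+x. ennreal (s x) * h x \<partial>M) =
    (\<integral>\<^sup>+t\<in>{0<..}. (\<integral>\<^sup>+x. h x * indicator {x. t < s x} x \<partial>M) \<partial>lborel)"
proof -
  interpret sigma_finite_measure M by fact
  interpret pair_sigma_finite lborel M ..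
  have "(\<integral>\<^sup>+x. ennreal (s x) * h x \<partial>M) =
      (\<integral>\<^sup>+x. (\<integral>\<^sup>+t. indicator {0<..<s x} t \<partial>lborel) * h x \<partial>M)"
  proof (intro nn_integral_cong arg_cong2[where f = "(*)"] refl)
    fix x
    show "ennreal (s x) = (\<integral>\<^sup>+t. indicator {0<..<s x} t \<partial>lborel)"
      by (cases "0 \<le> s x") (auto simp: ennreal_neg)
  qed
  also have "\<dots> = (\<integral>\<^sup>+x. (\<integral>\<^sup>+t. indicator {0<..<s x} t * h x \<partial>lborel) \<partial>M)"
    by (simp add: nn_integral_multc)
  also have "\<dots> = (\<integral>\<^sup>+t. (\<integral>\<^sup>+x. indicator {0<..<s x} t * h x \<partial>M) \<partial>lborel)"
    by (intro Fubini') (simp add: indicator_def greaterThanLessThan_iff)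
  also have "\<dots> = (\<integral>\<^sup>+t. (\<integral>\<^sup>+x. (h x * indicator {x. t < s x} x) * indicator {0<..} t \<partial>M) \<partial>lborel)"
    by (intro nn_integral_cong) (auto simp: indicator_def)
  also have "\<dots> = (\<integral>\<^sup>+t\<in>{0<..}. (\<integral>\<^sup>+x. h x * indicator {x. t < s x} x \<partial>M) \<partial>lborel)"
    by (intro nn_integral_cong) (auto simp: indicator_def)
  finally show ?thesis .
qed

section \<open>The quantile function of the absolute value\<close>

text \<open>The quantile at level 0 is the infimum of a set that is unbounded below, hence an arbitrary
  real number. Setting it to 0 makes the function nonnegative and nondecreasing on all of
  \<open>[0, 1)\<close>, where the spectral function lives.\<close>

definition abs_quantile :: "'a measure \<Rightarrow> ('a \<Rightarrow> real) \<Rightarrow> real \<Rightarrow> real" where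
  "abs_quantile M Y = (quantile M (\<lambda>x. \<bar>Y x\<bar>))(0 := 0)"

lemma prob_space_lborel01: "prob_space lborel01"
  by (auto simp: emeasure_restrict_space space_restrict_space intro!: prob_spaceI)

lemma nn_integral_lborel01:
  "(\<integral>\<^sup>+u. f u \<partial>lborel01) = (\<integral>\<^sup>+u\<in>{0<..<1}. f u \<partial>lborel)"
  using AE_lborel_singleton[of 0]
  by (subst nn_integral_restrict_space)
     (auto intro!: nn_integral_cong_AE elim!: eventually_mono simp: indicator_def)

lemma borel_measurable_lborel01_mono_on:
  "mono_on {0..<1} f \<Longrightarrow> (f :: real \<Rightarrow> real) \<in> borel_measurable lborel01"
  using borel_measurable_mono_on_fnc[of "{0..<1}" f]
  by (simp cong: measurable_cong_sets add: sets_restrict_space)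

context prob_space
begin

text \<open>The quantile function and the distribution function form a Galois connection, which transfers
  order properties between them.\<close>

lemma abs_quantile_le_iff:
  assumes [measurable]: "Y \<in> borel_measurable M" and u: "0 < u" "u < 1"
  shows "abs_quantile M Y u \<le> y \<longleftrightarrow> u \<le> prob {x \<in> space M. \<bar>Y x\<bar> \<le> y}"
proof -
  interpret D: cdf_distribution "distr M borel (\<lambda>x. \<bar>Y x\<bar>)"
    by (simp add: cdf_distribution_def)
  have "cdf (distr M borel (\<lambda>x. \<bar>Y x\<bar>)) y = prob {x \<in> space M. \<bar>Y x\<bar> \<le> y}"
    by (auto simp: cdf_def measure_distr intro!: arg_cong[where f = prob])
  then show ?thesis
    using D.pseudoinverse[OF u, of y] u by (simp add: abs_quantile_def quantile_eq_cdf)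
qed

lemma abs_quantile_nonneg:
  assumes "Y \<in> borel_measurable M" "u \<in> {0..<1}"
  shows "0 \<le> abs_quantile M Y u"
  using assms by (auto simp: abs_quantile_def intro!: quantile_nonneg)

lemma mono_on_abs_quantile:
  assumes Y: "Y \<in> borel_measurable M"
  shows "mono_on {0..<1} (abs_quantile M Y)"
proof (rule mono_onI)
  fix u v :: real assume uv: "u \<in> {0..<1}" "v \<in> {0..<1}" "u \<le> v"
  show "abs_quantile M Y u \<le> abs_quantile M Y v"
  proof (cases "u = 0")
    case True
    then show ?thesis
      using abs_quantile_nonneg[OF Y uv(2)] by (simp add: abs_quantile_def)
  next
    case False
    then show ?thesis
      using uv abs_quantile_le_iff[OF Y, of u] abs_quantile_le_iff[OF Y, of v "abs_quantile M Y v"]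
      by auto
  qed
qed

lemma measurable_abs_quantile [measurable]:
  "Y \<in> borel_measurable M \<Longrightarrow> abs_quantile M Y \<in> borel_measurable lborel01"
  by (intro borel_measurable_lborel01_mono_on mono_on_abs_quantile)

text \<open>The quantile transform: a quantile function evaluated at a uniform variable has the law that
  it comes from. Changing its value at 0 preserves this, a point being a null set.\<close>

lemma distr_abs_quantile:
  assumes [measurable]: "Y \<in> borel_measurable M"
  shows "distr lborel01 borel (abs_quantile M Y) = distr M borel (\<lambda>x. \<bar>Y x\<bar>)"
proof -
  interpret D: cdf_distribution "distr M borel (\<lambda>x. \<bar>Y x\<bar>)"
    by (simp add: cdf_distribution_def)
  let ?U = "restrict_space lborel {0<..<1::real}"
  have meas [measurable]: "D.I \<in> borel_measurable ?U"
    using D.measurable_CI by (simp cong: measurable_cong_sets add: sets_restrict_space)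
  have "distr lborel01 borel (abs_quantile M Y) = distr ?U borel D.I"
  proof (rule measure_eqI)
    fix A assume "A \<in> sets (distr lborel01 borel (abs_quantile M Y))"
    then have [measurable]: "A \<in> sets borel"
      by simp
    have "emeasure (distr lborel01 borel (abs_quantile M Y)) A =
        (\<integral>\<^sup>+u. indicator A (abs_quantile M Y u) \<partial>lborel01)"
      by (simp flip: nn_integral_indicator add: nn_integral_distr)
    also have "\<dots> = (\<integral>\<^sup>+u. indicator A (D.I u) \<partial>?U)"
      by (subst nn_integral_lborel01, subst nn_integral_restrict_space)
         (auto intro!: nn_integral_cong simp: abs_quantile_def quantile_eq_cdf indicator_def)
    also have "\<dots> = emeasure (distr ?U borel D.I) A"
      by (simp flip: nn_integral_indicator add: nn_integral_distr)
    finally show "emeasure (distr lborel01 borel (abs_quantile M Y)) A = emeasure (distr ?U borel D.I) A" .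
  qed simp
  then show ?thesis
    by (simp add: D.distr_I_eq_M)
qed

lemma nn_integral_abs_quantile:
  assumes [measurable]: "Y \<in> borel_measurable M" "h \<in> borel_measurable borel"
  shows "(\<integral>\<^sup>+u. h (abs_quantile M Y u) \<partial>lborel01) = (\<integral>\<^sup>+x. h \<bar>Y x\<bar> \<partial>M)"
proof -
  have "(\<integral>\<^sup>+u. h (abs_quantile M Y u) \<partial>lborel01) = (\<integral>\<^sup>+y. h y \<partial>distr lborel01 borel (abs_quantile M Y))"
    by (simp add: nn_integral_distr)
  also have "\<dots> = (\<integral>\<^sup>+x. h \<bar>Y x\<bar> \<partial>M)"
    by (simp add: distr_abs_quantile nn_integral_distr)
  finally show ?thesis .
qed

lemma Lp_norm_abs_quantile:
  assumes [measurable]: "Y \<in> borel_measurable M"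
  shows "Lp_norm lborel01 p (abs_quantile M Y) = Lp_norm M p Y"
proof -
  have "Lp_norm lborel01 p (abs_quantile M Y) = Lp_norm (distr lborel01 borel (abs_quantile M Y)) p (\<lambda>y. y)"
    by (simp add: Lp_norm_distr)
  also have "\<dots> = Lp_norm M p Y"
    by (simp add: distr_abs_quantile Lp_norm_distr Lp_norm_abs)
  finally show ?thesis .
qed

lemma abs_quantile_cmult:
  assumes [measurable]: "Y \<in> borel_measurable M" and u: "u \<in> {0..<1}"
  shows "abs_quantile M (\<lambda>x. c * Y x) u = \<bar>c\<bar> * abs_quantile M Y u"
proof (cases "u = 0")
  case True
  then show ?thesis
    by (simp add: abs_quantile_def)
next
  case False
  then have u: "0 < u" "u < 1"
    using u by auto
  show ?thesis
  proof (cases "c = 0")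
    case True
    have "u \<le> prob {x \<in> space M. \<bar>c * Y x\<bar> \<le> 0}"
      using True u prob_space by simp
    then have "abs_quantile M (\<lambda>x. c * Y x) u \<le> 0"
      using u by (simp add: abs_quantile_le_iff)
    moreover have "0 \<le> abs_quantile M (\<lambda>x. c * Y x) u"
      using u by (intro abs_quantile_nonneg) auto
    ultimately show ?thesis
      using True by simp
  next
    case False
    have scale: "\<bar>c\<bar> * z \<le> y \<longleftrightarrow> z \<le> y / \<bar>c\<bar>" for y z
      using False by (simp add: pos_le_divide_eq mult.commute)
    \<comment> \<open>Two reals with the same upper bounds are equal.\<close>
    have "abs_quantile M (\<lambda>x. c * Y x) u \<le> y \<longleftrightarrow> \<bar>c\<bar> * abs_quantile M Y u \<le> y" for y
    proof -
      have "abs_quantile M (\<lambda>x. c * Y x) u \<le> y \<longleftrightarrow> u \<le> prob {x \<in> space M. \<bar>Y x\<bar> \<le> y / \<bar>c\<bar>}"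
        using False u by (simp add: abs_quantile_le_iff abs_mult scale)
      also have "\<dots> \<longleftrightarrow> \<bar>c\<bar> * abs_quantile M Y u \<le> y"
        using u by (simp flip: abs_quantile_le_iff add: scale)
      finally show ?thesis .
    qed
    then show ?thesis
      by (meson order.antisym order.refl)
  qed
qed

section \<open>Tail integrals of the quantile function\<close>

text \<open>On \<open>A\<close> the quantile function is at most \<open>c\<close> plus its excess over \<open>c\<close>, and the excess has the same
  integral as that of \<open>\<bar>Y\<bar>\<close>.\<close>

lemma tail_integral_le:
  assumes [measurable]: "Y \<in> borel_measurable M" "A \<in> sets lborel01"
    and c: "0 \<le> c"
  shows "(\<integral>\<^sup>+u. ennreal (abs_quantile M Y u) * indicator A u \<partial>lborel01) \<le>
    ennreal c * emeasure lborel01 A + (\<integral>\<^sup>+x. ennreal (\<bar>Y x\<bar> - c) \<partial>M)"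
proof -
  have "(\<integral>\<^sup>+u. ennreal (abs_quantile M Y u) * indicator A u \<partial>lborel01) \<le>
      (\<integral>\<^sup>+u. ennreal c * indicator A u + ennreal (abs_quantile M Y u - c) \<partial>lborel01)"
  proof (rule nn_integral_mono)
    fix u
    have "ennreal (abs_quantile M Y u) \<le> ennreal (c + max 0 (abs_quantile M Y u - c))"
      by (intro ennreal_leI) auto
    also have "\<dots> = ennreal c + ennreal (abs_quantile M Y u - c)"
      using c by (subst ennreal_plus) (auto simp: ennreal_neg max_def)
    finally show "ennreal (abs_quantile M Y u) * indicator A u \<le>
        ennreal c * indicator A u + ennreal (abs_quantile M Y u - c)"
      by (simp add: indicator_def)
  qed
  also have "\<dots> = ennreal c * emeasure lborel01 A + (\<integral>\<^sup>+x. ennreal (\<bar>Y x\<bar> - c) \<partial>M)"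
    using nn_integral_abs_quantile[of Y "\<lambda>y. ennreal (y - c)"]
    by (simp add: nn_integral_add nn_integral_cmult)
  finally show ?thesis .
qed

text \<open>The bound \<open>tail_integral_le\<close> is attained when \<open>c\<close> separates the values of the quantile
  function on \<open>A\<close> from those to the left of \<open>A\<close>. Then there is no excess outside \<open>A\<close> and the excess
  on \<open>A\<close> is the full difference.\<close>

lemma tail_integral_eq:
  assumes [measurable]: "Y \<in> borel_measurable M" "A \<in> sets lborel01"
    and ne: "A \<noteq> {}" and upper: "\<forall>u\<in>A. {u..<1} \<subseteq> A"
  obtains c where "0 \<le> c"
    "(\<integral>\<^sup>+u. ennreal (abs_quantile M Y u) * indicator A u \<partial>lborel01) =
      ennreal c * emeasure lborel01 A + (\<integral>\<^sup>+x. ennreal (\<bar>Y x\<bar> - c) \<partial>M)"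
proof -
  define c where "c = Inf (abs_quantile M Y ` A)"
  have A: "A \<subseteq> {0..<1}"
    using sets.sets_into_space[OF assms(2)] by (simp add: space_restrict_space)
  have nonneg: "0 \<le> abs_quantile M Y u" if "u \<in> {0..<1}" for u
    using that by (simp add: abs_quantile_nonneg)
  have c: "0 \<le> c"
    unfolding c_def using ne A nonneg by (intro cINF_greatest) auto
  have above: "c \<le> abs_quantile M Y u" if "u \<in> A" for u
    unfolding c_def using that A nonneg by (intro cINF_lower bdd_belowI2[where m = 0]) auto
  have below: "abs_quantile M Y u \<le> c" if "u \<in> {0..<1} - A" for u
    unfolding c_def
  proof (rule cINF_greatest[OF ne])
    fix v assume v: "v \<in> A"
    then have "u \<le> v"
      using upper that by (force simp: subset_eq)
    then show "abs_quantile M Y u \<le> abs_quantile M Y v"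
      using mono_on_abs_quantile[of Y] v A that by (auto simp: mono_on_def)
  qed
  have "(\<integral>\<^sup>+u. ennreal (abs_quantile M Y u) * indicator A u \<partial>lborel01) =
      (\<integral>\<^sup>+u. ennreal c * indicator A u + ennreal (abs_quantile M Y u - c) \<partial>lborel01)"
  proof (rule nn_integral_cong)
    fix u assume "u \<in> space lborel01"
    then have u: "u \<in> {0..<1}"
      by (simp add: space_restrict_space)
    show "ennreal (abs_quantile M Y u) * indicator A u =
        ennreal c * indicator A u + ennreal (abs_quantile M Y u - c)"
    proof (cases "u \<in> A")
      case True
      then show ?thesis
        using above[OF True] c by (simp flip: ennreal_plus)
    next
      case False
      then show ?thesis
        using below[of u] u by (simp add: ennreal_neg)
    qed
  qed
  also have "\<dots> = ennreal c * emeasure lborel01 A + (\<integral>\<^sup>+x. ennreal (\<bar>Y x\<bar> - c) \<partial>M)"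
    using nn_integral_abs_quantile[of Y "\<lambda>y. ennreal (y - c)"]
    by (simp add: nn_integral_add nn_integral_cmult)
  finally show ?thesis
    using that c by blast
qed

text \<open>Take the optimal \<open>c\<close> for \<open>X\<close> and \<open>d\<close> for \<open>Y\<close>, and bound the tail integral of the sum using \<open>c + d\<close>:
  the excess of \<open>\<bar>X + Y\<bar>\<close> over \<open>c + d\<close> is at most the sum of the two excesses.\<close>

lemma tail_integral_add_le:
  assumes [measurable]: "X \<in> borel_measurable M" "Y \<in> borel_measurable M" "A \<in> sets lborel01"
    and upper: "\<forall>u\<in>A. {u..<1} \<subseteq> A"
  shows "(\<integral>\<^sup>+u. ennreal (abs_quantile M (\<lambda>x. X x + Y x) u) * indicator A u \<partial>lborel01) \<le>
    (\<integral>\<^sup>+u. ennreal (abs_quantile M X u) * indicator A u \<partial>lborel01) +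
    (\<integral>\<^sup>+u. ennreal (abs_quantile M Y u) * indicator A u \<partial>lborel01)"
proof (cases "A = {}")
  case False
  obtain c where c: "0 \<le> c"
    "(\<integral>\<^sup>+u. ennreal (abs_quantile M X u) * indicator A u \<partial>lborel01) =
      ennreal c * emeasure lborel01 A + (\<integral>\<^sup>+x. ennreal (\<bar>X x\<bar> - c) \<partial>M)"
    by (rule tail_integral_eq[OF assms(1,3) False upper])
  obtain d where d: "0 \<le> d"
    "(\<integral>\<^sup>+u. ennreal (abs_quantile M Y u) * indicator A u \<partial>lborel01) =
      ennreal d * emeasure lborel01 A + (\<integral>\<^sup>+x. ennreal (\<bar>Y x\<bar> - d) \<partial>M)"
    by (rule tail_integral_eq[OF assms(2,3) False upper])
  have "(\<integral>\<^sup>+u. ennreal (abs_quantile M (\<lambda>x. X x + Y x) u) * indicator A u \<partial>lborel01) \<le>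
      ennreal (c + d) * emeasure lborel01 A + (\<integral>\<^sup>+x. ennreal (\<bar>X x + Y x\<bar> - (c + d)) \<partial>M)"
    using c d by (intro tail_integral_le) auto
  also have "(\<integral>\<^sup>+x. ennreal (\<bar>X x + Y x\<bar> - (c + d)) \<partial>M) \<le>
      (\<integral>\<^sup>+x. ennreal (\<bar>X x\<bar> - c) + ennreal (\<bar>Y x\<bar> - d) \<partial>M)"
  proof (rule nn_integral_mono)
    fix x
    have "ennreal (\<bar>X x + Y x\<bar> - (c + d)) \<le> ennreal (max 0 (\<bar>X x\<bar> - c) + max 0 (\<bar>Y x\<bar> - d))"
      by (intro ennreal_leI) auto
    also have "\<dots> = ennreal (\<bar>X x\<bar> - c) + ennreal (\<bar>Y x\<bar> - d)"
      by (subst ennreal_plus) (auto simp: max_def ennreal_neg)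
    finally show "ennreal (\<bar>X x + Y x\<bar> - (c + d)) \<le> ennreal (\<bar>X x\<bar> - c) + ennreal (\<bar>Y x\<bar> - d)" .
  qed
  also have "\<dots> = (\<integral>\<^sup>+x. ennreal (\<bar>X x\<bar> - c) \<partial>M) + (\<integral>\<^sup>+x. ennreal (\<bar>Y x\<bar> - d) \<partial>M)"
    by (simp add: nn_integral_add)
  finally show ?thesis
    using c d by (simp add: ennreal_plus distrib_right ac_simps add_left_mono)
qed simp

section \<open>The spectral norm\<close>

lemma sigma_norm_eq:
  assumes \<sigma>: "spectral_function \<sigma>" and Y: "Y \<in> borel_measurable M"
  shows "sigma_norm M \<sigma> Y = (\<integral>\<^sup>+u. ennreal (\<sigma> u * abs_quantile M Y u) \<partial>lborel01)"
  unfolding spectral_risk_abs_eq(2)[OF assms] nn_integral_lborel01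
  by (intro nn_integral_cong) (auto simp: abs_quantile_def indicator_def)

lemma measurable_spectral_function:
  "spectral_function \<sigma> \<Longrightarrow> \<sigma> \<in> borel_measurable lborel01"
  by (simp add: spectral_function_def borel_measurable_lborel01_mono_on)

text \<open>The weight \<open>\<sigma>\<close> has mean one and puts more mass where the quantile function is larger, so the
  weighted mean is at least the plain mean.\<close>

lemma L1_norm_le_sigma_norm:
  assumes \<sigma>: "spectral_function \<sigma>" and Y [measurable]: "Y \<in> borel_measurable M"
  shows "Lp_norm M 1 Y \<le> sigma_norm M \<sigma> Y"
proof -
  have "Lp_norm M 1 Y = (\<integral>\<^sup>+u. ennreal (\<sigma> u) \<partial>lborel01) * (\<integral>\<^sup>+u. ennreal (abs_quantile M Y u) \<partial>lborel01)"
    using \<sigma> nn_integral_abs_quantile[OF Y, of ennreal]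
    unfolding Lp_norm_one spectral_function_def by simp
  also have "\<dots> \<le> sigma_norm M \<sigma> Y"
    unfolding sigma_norm_eq[OF \<sigma> Y]
    using \<sigma> mono_on_abs_quantile[OF Y]
    by (intro Chebyshev_integral_inequality prob_space_lborel01 measurable_spectral_function[OF \<sigma>]
        measurable_abs_quantile)
       (auto simp: spectral_function_def space_restrict_space abs_quantile_nonneg)
  finally show ?thesis .
qed

lemma sigma_norm_le_Lp_norm:
  assumes \<sigma>: "spectral_function \<sigma>" "\<sigma> \<in> Lp_space lborel01 q" and pq: "1 / p + 1 / q = 1"
    and Y: "Y \<in> Lp_space M p"
  shows "sigma_norm M \<sigma> Y \<le> Lp_norm lborel01 q \<sigma> * Lp_norm M p Y"
proof -
  have Y' [measurable]: "Y \<in> borel_measurable M"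
    using Y by (simp add: Lp_space_def)
  have "sigma_norm M \<sigma> Y \<le> (\<integral>\<^sup>+u. ennreal \<bar>\<sigma> u * abs_quantile M Y u\<bar> \<partial>lborel01)"
    unfolding sigma_norm_eq[OF \<sigma>(1) Y'] by (intro nn_integral_mono ennreal_leI) simp
  also have "\<dots> \<le> Lp_norm lborel01 q \<sigma> * Lp_norm lborel01 p (abs_quantile M Y)"
    using \<sigma>(2) pq Y
    by (intro nn_integral_Holder) (auto simp: Lp_space_def Lp_norm_abs_quantile add.commute)
  finally show ?thesis
    by (simp add: Lp_norm_abs_quantile)
qed

text \<open>\<open>\<parallel>Z\<parallel>\<^sub>\<sigma>\<close> is the integral over \<open>t\<close> of the tail integrals \<open>tail Z t\<close> over \<open>{\<sigma> > t}\<close>. As \<open>\<sigma>\<close> is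
  nondecreasing these sets are closed upwards, so each tail integral is subadditive.\<close>

lemma sigma_norm_triangle:
  assumes \<sigma>: "spectral_function \<sigma>"
    and [measurable]: "X \<in> borel_measurable M" "Y \<in> borel_measurable M"
  shows "sigma_norm M \<sigma> (\<lambda>x. X x + Y x) \<le> sigma_norm M \<sigma> X + sigma_norm M \<sigma> Y"
proof -
  interpret U: prob_space lborel01
    by (rule prob_space_lborel01)
  have [measurable]: "\<sigma> \<in> borel_measurable lborel01"
    using \<sigma> by (rule measurable_spectral_function)
  define tail where
    "tail Z t = (\<integral>\<^sup>+u. ennreal (abs_quantile M Z u) * indicator {u. t < \<sigma> u} u \<partial>lborel01)" for Z t
  have layers: "sigma_norm M \<sigma> Z = (\<integral>\<^sup>+t\<in>{0<..}. tail Z t \<partial>lborel)"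
    if [measurable]: "Z \<in> borel_measurable M" for Z
  proof -
    have "sigma_norm M \<sigma> Z = (\<integral>\<^sup>+u. ennreal (\<sigma> u) * ennreal (abs_quantile M Z u) \<partial>lborel01)"
      unfolding sigma_norm_eq[OF \<sigma> that] using \<sigma>
      by (intro nn_integral_cong ennreal_mult')
         (auto simp: spectral_function_def space_restrict_space)
    also have "\<dots> = (\<integral>\<^sup>+t\<in>{0<..}. tail Z t \<partial>lborel)"
      unfolding tail_def by (intro nn_integral_layer_cake U.sigma_finite_measure) auto
    finally show ?thesis .
  qed
  have [measurable]: "tail Z \<in> borel_measurable lborel"
    if [measurable]: "Z \<in> borel_measurable M" for Z
    unfolding tail_def by measurable
  have "tail (\<lambda>x. X x + Y x) t \<le> tail X t + tail Y t" for t
  proof -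
    let ?A = "{u \<in> {0..<1}. t < \<sigma> u}"
    have eq: "tail Z t = (\<integral>\<^sup>+u. ennreal (abs_quantile M Z u) * indicator ?A u \<partial>lborel01)" for Z
      unfolding tail_def by (intro nn_integral_cong) (auto simp: space_restrict_space indicator_def)
    have "{u \<in> space lborel01. t < \<sigma> u} \<in> sets lborel01"
      by measurable
    then have "?A \<in> sets lborel01"
      by (simp add: space_restrict_space)
    moreover have "\<forall>u\<in>?A. {u..<1} \<subseteq> ?A"
    proof (intro ballI subsetI)
      fix u v assume uv: "u \<in> ?A" "v \<in> {u..<1}"
      have "\<sigma> u \<le> \<sigma> v"
        using \<sigma> uv by (auto simp: spectral_function_def intro: mono_onD)
      then show "v \<in> ?A"
        using uv by simp
    qed
    ultimately show ?thesis
      unfolding eq using assms(2,3) by (intro tail_integral_add_le)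
  qed
  then have "sigma_norm M \<sigma> (\<lambda>x. X x + Y x) \<le> (\<integral>\<^sup>+t\<in>{0<..}. tail X t + tail Y t \<partial>lborel)"
    by (simp add: layers nn_integral_mono mult_right_mono)
  also have "\<dots> = sigma_norm M \<sigma> X + sigma_norm M \<sigma> Y"
    by (simp add: layers distrib_right nn_integral_add)
  finally show ?thesis .
qed

lemma sigma_norm_cmult:
  assumes \<sigma>: "spectral_function \<sigma>" and [measurable]: "Y \<in> borel_measurable M"
  shows "sigma_norm M \<sigma> (\<lambda>x. c * Y x) = ennreal \<bar>c\<bar> * sigma_norm M \<sigma> Y"
proof -
  have [measurable]: "\<sigma> \<in> borel_measurable lborel01"
    using \<sigma> by (rule measurable_spectral_function)
  have "sigma_norm M \<sigma> (\<lambda>x. c * Y x) =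
      (\<integral>\<^sup>+u. ennreal \<bar>c\<bar> * ennreal (\<sigma> u * abs_quantile M Y u) \<partial>lborel01)"
    unfolding sigma_norm_eq[OF \<sigma> borel_measurable_times[OF borel_measurable_const assms(2)]]
  proof (rule nn_integral_cong)
    fix u assume "u \<in> space lborel01"
    then have "abs_quantile M (\<lambda>x. c * Y x) u = \<bar>c\<bar> * abs_quantile M Y u"
      by (intro abs_quantile_cmult) (auto simp: space_restrict_space)
    then have "\<sigma> u * abs_quantile M (\<lambda>x. c * Y x) u = \<bar>c\<bar> * (\<sigma> u * abs_quantile M Y u)"
      by simp
    then show "ennreal (\<sigma> u * abs_quantile M (\<lambda>x. c * Y x) u) =
        ennreal \<bar>c\<bar> * ennreal (\<sigma> u * abs_quantile M Y u)"
      by (simp only: ennreal_mult'[OF abs_ge_zero])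
  qed
  also have "\<dots> = ennreal \<bar>c\<bar> * sigma_norm M \<sigma> Y"
    using \<sigma> by (simp add: sigma_norm_eq nn_integral_cmult)
  finally show ?thesis .
qed

lemma sigma_space_subset_L1:
  assumes "spectral_function \<sigma>"
  shows "sigma_space M \<sigma> \<subseteq> Lp_space M 1"
proof
  fix Y assume "Y \<in> sigma_space M \<sigma>"
  then show "Y \<in> Lp_space M 1"
    using le_less_trans[OF L1_norm_le_sigma_norm[OF assms, of Y], of \<top>]
    by (simp add: sigma_space_def Lp_space_def)
qed

lemma Lp_space_subset_sigma_space:
  assumes "spectral_function \<sigma>" "\<sigma> \<in> Lp_space lborel01 q" "1 / p + 1 / q = 1"
  shows "Lp_space M p \<subseteq> sigma_space M \<sigma>"
proof
  fix Y assume Y: "Y \<in> Lp_space M p"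
  then have "sigma_norm M \<sigma> Y \<le> Lp_norm lborel01 q \<sigma> * Lp_norm M p Y"
    by (rule sigma_norm_le_Lp_norm[OF assms])
  also have "\<dots> < \<top>"
    using assms Y by (simp add: Lp_space_def ennreal_mult_less_top)
  finally show "Y \<in> sigma_space M \<sigma>"
    using Y by (simp add: Lp_space_def sigma_space_def)
qed

lemma is_norm_AE_cong:
  assumes N: "is_norm_AE M V N" and eq: "\<And>f. f \<in> V \<Longrightarrow> N' f = N f"
  shows "is_norm_AE M V N'"
proof -
  have add: "(\<lambda>x. f x + g x) \<in> V" if "f \<in> V" "g \<in> V" for f g
    using N that by (simp add: is_norm_AE_def)
  have cmult: "(\<lambda>x. c * f x) \<in> V" if "f \<in> V" for f c
    using N that by (simp add: is_norm_AE_def)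
  have "is_norm_AE M V N' \<longleftrightarrow> is_norm_AE M V N"
    unfolding is_norm_AE_def
    by (intro arg_cong2[where f = "(\<and>)"] arg_cong2[where f = "(\<longrightarrow>)"] ball_cong all_cong1 refl)
       (simp_all add: add cmult eq)
  with N show ?thesis
    by simp
qed

proposition is_norm_AE_sigma_norm:
  assumes \<sigma>: "spectral_function \<sigma>"
  shows "is_norm_AE M (sigma_space M \<sigma>) (sigma_norm M \<sigma>)"
proof -
  have zero: "sigma_norm M \<sigma> (\<lambda>x. 0) = 0"
    using sigma_norm_cmult[OF \<sigma>, of "\<lambda>x. 0" 0] by simp
  have definite: "sigma_norm M \<sigma> f = 0 \<longleftrightarrow> (AE x in M. f x = 0)"
    if [measurable]: "f \<in> borel_measurable M" for f
  proof
    assume "sigma_norm M \<sigma> f = 0"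
    then have "(\<integral>\<^sup>+x. ennreal \<bar>f x\<bar> \<partial>M) = 0"
      using L1_norm_le_sigma_norm[OF \<sigma> that] by (simp add: Lp_norm_one)
    then show "AE x in M. f x = 0"
      by (subst (asm) nn_integral_0_iff_AE) auto
  next
    assume "AE x in M. f x = 0"
    then show "sigma_norm M \<sigma> f = 0"
      using sigma_norm_cong_AE[of f M "\<lambda>x. 0"] zero that by simp
  qed
  have add: "(\<lambda>x. f x + g x) \<in> sigma_space M \<sigma>"
    if "f \<in> sigma_space M \<sigma>" "g \<in> sigma_space M \<sigma>" for f g
    using that le_less_trans[OF sigma_norm_triangle[OF \<sigma>, of f g], of \<top>]
    by (simp add: sigma_space_def borel_measurable_add)
  have cmult: "(\<lambda>x. c * f x) \<in> sigma_space M \<sigma>" if "f \<in> sigma_space M \<sigma>" for f c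
    using that
    by (simp add: sigma_space_def sigma_norm_cmult[OF \<sigma>] ennreal_mult_less_top borel_measurable_times)
  have meas: "f \<in> borel_measurable M" and fin: "sigma_norm M \<sigma> f < \<top>"
    if "f \<in> sigma_space M \<sigma>" for f
    using that by (simp_all add: sigma_space_def)
  show ?thesis
    unfolding is_norm_AE_def
  proof (intro conjI ballI allI impI)
    show "(\<lambda>x. 0) \<in> sigma_space M \<sigma>"
      using zero by (simp add: sigma_space_def)
    show "sigma_norm M \<sigma> f = sigma_norm M \<sigma> g"
      if "f \<in> sigma_space M \<sigma>" "g \<in> sigma_space M \<sigma>" "AE x in M. f x = g x" for f g
      using that meas by (intro sigma_norm_cong_AE)
  qed (simp_all add: add cmult fin meas definite sigma_norm_cmult[OF \<sigma>] sigma_norm_triangle[OF \<sigma>])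
qed

text \<open>The \<open>L\<^sup>1\<close> norm is the spectral norm of the constant spectral function 1.\<close>

corollary is_norm_AE_L1: "is_norm_AE M (Lp_space M 1) (Lp_norm M 1)"
proof -
  have one: "spectral_function (\<lambda>u. 1)"
    using prob_space.emeasure_space_1[OF prob_space_lborel01]
    by (simp add: spectral_function_def mono_on_def)
  have norm: "sigma_norm M (\<lambda>u. 1) f = Lp_norm M 1 f" if "f \<in> borel_measurable M" for f
    using that by (simp add: sigma_norm_eq[OF one] Lp_norm_one nn_integral_abs_quantile[of f ennreal])
  then have space: "sigma_space M (\<lambda>u. 1) = Lp_space M 1"
    by (auto simp: sigma_space_def Lp_space_def)
  show ?thesis
    using is_norm_AE_sigma_norm[OF one] unfolding space
    by (rule is_norm_AE_cong) (simp add: norm Lp_space_def)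
qed

end

section \<open>Comparison of the spaces\<close>

theorem theorem11:
  fixes M :: "'a measure" and \<sigma> :: "real \<Rightarrow> real"
  assumes "prob_space M" and "spectral_function \<sigma>"
  shows "(\<forall>p q :: ennreal. 1 \<le> q \<longrightarrow> 1 / p + 1 / q = 1 \<longrightarrow> \<sigma> \<in> Lp_space lborel01 q \<longrightarrow>
            Lp_space M \<top> \<subseteq> Lp_space M p \<and>
            Lp_space M p \<subseteq> sigma_space M \<sigma> \<and>
            sigma_space M \<sigma> \<subseteq> Lp_space M 1 \<and>
            (\<forall>Y\<in>Lp_space M p.
               Lp_norm M 1 Y \<le> sigma_norm M \<sigma> Y \<and>
               sigma_norm M \<sigma> Y \<le> Lp_norm lborel01 q \<sigma> * Lp_norm M p Y))
       \<and> (\<sigma> \<in> Lp_space lborel01 \<top> \<longrightarrow>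
            sigma_space M \<sigma> = Lp_space M 1 \<and>
            equivalent_norms_AE M (Lp_space M 1) (Lp_norm M 1) (sigma_norm M \<sigma>) \<and>
            (\<forall>Y\<in>Lp_space M 1.
               Lp_norm M 1 Y \<le> sigma_norm M \<sigma> Y \<and>
               sigma_norm M \<sigma> Y \<le> Lp_norm lborel01 \<top> \<sigma> * Lp_norm M 1 Y))"
    (is "?chain \<and> ?bounded")
proof
  interpret prob_space M by fact
  note \<sigma> = \<open>spectral_function \<sigma>\<close>
  have lower: "Lp_norm M 1 Y \<le> sigma_norm M \<sigma> Y" if "Y \<in> Lp_space M p" for Y p
    using that by (intro L1_norm_le_sigma_norm[OF \<sigma>]) (simp add: Lp_space_def)
  show ?chain
    using Lp_space_top_subset Lp_space_subset_sigma_space[OF \<sigma>] sigma_space_subset_L1[OF \<sigma>]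
      lower sigma_norm_le_Lp_norm[OF \<sigma>]
    by blast
  show ?bounded
  proof (rule impI)
    assume bounded: "\<sigma> \<in> Lp_space lborel01 \<top>"
    have conj: "1 / 1 + 1 / \<top> = (1 :: ennreal)"
      by simp
    have space: "sigma_space M \<sigma> = Lp_space M 1"
      using Lp_space_subset_sigma_space[OF \<sigma> bounded conj] sigma_space_subset_L1[OF \<sigma>] by blast
    have upper: "sigma_norm M \<sigma> Y \<le> Lp_norm lborel01 \<top> \<sigma> * Lp_norm M 1 Y" if "Y \<in> Lp_space M 1" for Y
      using sigma_norm_le_Lp_norm[OF \<sigma> bounded conj that] .
    obtain K where K: "0 \<le> K" "Lp_norm lborel01 \<top> \<sigma> = ennreal K"
      using bounded by (cases "Lp_norm lborel01 \<top> \<sigma>") (auto simp: Lp_space_def)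
    \<comment> \<open>Equivalence of norms asks for a positive constant; \<open>K + 1\<close> is one for every \<open>K \<ge> 0\<close>.\<close>
    have "sigma_norm M \<sigma> Y \<le> ennreal (K + 1) * Lp_norm M 1 Y" if "Y \<in> Lp_space M 1" for Y
      using upper[OF that] K by (elim order_trans) (auto intro!: mult_right_mono ennreal_leI)
    then have "\<exists>c C :: real. 0 < c \<and> 0 < C \<and> (\<forall>Y\<in>Lp_space M 1.
        ennreal c * Lp_norm M 1 Y \<le> sigma_norm M \<sigma> Y \<and> sigma_norm M \<sigma> Y \<le> ennreal C * Lp_norm M 1 Y)"
      using K lower by (intro exI[of _ 1] exI[of _ "K + 1"]) auto
    then have "equivalent_norms_AE M (Lp_space M 1) (Lp_norm M 1) (sigma_norm M \<sigma>)"
      using is_norm_AE_L1 is_norm_AE_sigma_norm[OF \<sigma>] unfolding space equivalent_norms_AE_def by blast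
    then show "sigma_space M \<sigma> = Lp_space M 1 \<and>
        equivalent_norms_AE M (Lp_space M 1) (Lp_norm M 1) (sigma_norm M \<sigma>) \<and>
        (\<forall>Y\<in>Lp_space M 1. Lp_norm M 1 Y \<le> sigma_norm M \<sigma> Y \<and>
          sigma_norm M \<sigma> Y \<le> Lp_norm lborel01 \<top> \<sigma> * Lp_norm M 1 Y)"
      using space lower upper by blast
  qed
qed

end
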